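(* Let $1<p<\infty$, let $n\ge 1$ be an integer and let $f\in L^p(\mathbb{R})$. Then $$\|M^nf\|_{L^p(\mathbb{R})}\ge \left(\frac{\gamma_n p}{p-1}\right)^{1/p}\|f\|_{L^p(\mathbb{R})}.$$
   Context: Functions are real-valued. $M$ is the centered Hardy-Littlewood maximal operator on the real line, $$Mf(x)=\sup_{r>0}\frac{1}{2r}\int_{x-r}^{x+r}|f(y)|\,dy,\quad x\in\mathbb{R},$$ and $M^n$ is its $n$-fold iteration: $M^1f:=Mf$ and $M^nf:=M(M^{n-1}f)$ for $n\ge 2$. Define functions $g_n:[-1/2,\infty)\to[0,1]$ for integers $n\ge 0$ by $g_0\equiv 0$ and, for $n\ge 1$, $$g_n(t):=\frac{1+\int_0^{1+2t}g_{n-1}(u)\,du}{2(1+t)},\quad t\ge -\tfrac12.$$ For each integer $n\ge 1$ set $\gamma_n:=g_n(0)$. *)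

theory Defs
  imports "HOL-Analysis.Analysis"
begin

text \<open>Maximal functions and $L^p$ norms take values in \<^typ>\<open>ennreal\<close>: for $f \in L^p$ the maximal
  function is finite almost everywhere, but it may be infinite at individual points.\<close>

text \<open>Intended for exponents \<open>a > 0\<close> only.\<close>

definition ennreal_rpow :: "ennreal \<Rightarrow> real \<Rightarrow> ennreal" where
  "ennreal_rpow x a = (if x = \<infinity> then \<infinity> else ennreal (enn2real x powr a))"

text \<open>The functions below are applied to \<open>|f|\<close>, so that real-valued \<open>f\<close> and the \<open>ennreal\<close>-valued
  iterates of the maximal operator are treated uniformly.\<close>

definition Lp_norm :: "real \<Rightarrow> (real \<Rightarrow> ennreal) \<Rightarrow> ennreal" where
  "Lp_norm p h = ennreal_rpow (\<integral>\<^sup>+x. ennreal_rpow (h x) p \<partial>lebesgue) (1 / p)"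

definition in_Lp :: "real \<Rightarrow> (real \<Rightarrow> real) \<Rightarrow> bool" where
  "in_Lp p f \<longleftrightarrow> f \<in> borel_measurable lebesgue \<and> Lp_norm p (\<lambda>x. ennreal \<bar>f x\<bar>) < \<infinity>"

definition hl_max :: "(real \<Rightarrow> ennreal) \<Rightarrow> real \<Rightarrow> ennreal" where
  "hl_max h x = (SUP r\<in>{0<..}. ennreal (1 / (2 * r)) * (\<integral>\<^sup>+y\<in>{x - r..x + r}. h y \<partial>lebesgue))"

text \<open>$M^n f$ for \<open>n \<ge> 1\<close>.\<close>

definition hl_max_iter :: "nat \<Rightarrow> (real \<Rightarrow> real) \<Rightarrow> real \<Rightarrow> ennreal" where
  "hl_max_iter n f = (hl_max ^^ n) (\<lambda>y. ennreal \<bar>f y\<bar>)"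

text \<open>Only the values at \<open>t \<ge> -1/2\<close> are meaningful. The recursion evaluates \<open>g n\<close> on
  \<open>{0..1 + 2 * t}\<close> only, so values outside that domain never enter.\<close>

primrec g :: "nat \<Rightarrow> real \<Rightarrow> real" where
  "g 0 = (\<lambda>t. 0)"
| "g (Suc n) = (\<lambda>t. (1 + integral {0..1 + 2 * t} (g n)) / (2 * (1 + t)))"

definition gamma_seq :: "nat \<Rightarrow> real" where
  "gamma_seq n = g n 0"

end

theory Submission
  imports Defs
begin

text \<open>Write \<open>M\<close> for the maximal operator \<^const>\<open>hl_max\<close>, \<open>h = |f|\<close> and \<open>\<gamma> = gamma_seq n\<close>. The theorem is a
  consequence of a reverse weak-type inequality: for every \<open>c > 0\<close>, the set \<open>U = {M\<^sup>n h > c}\<close>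
  satisfies \<open>\<gamma> * (integral of h over U) \<le> c * |U|\<close>
  (lemma \<open>measure_superlevel_funpow_hl_max_ge\<close>).

  To see why this holds, note that \<open>U\<close> is open (\<open>open_superlevel_hl_max\<close>). If its measure is finite, it
  is a countable disjoint union of bounded open intervals \<open>(a, b)\<close>, and none of the endpoints belongs to \<open>U\<close>.
  On the other hand, the mass of \<open>h\<close> in \<open>(a, b)\<close> is felt to the right of that interval: if \<open>A\<close> is the
  average of \<open>h\<close> over \<open>(a, b)\<close>, then \<open>M\<^sup>n h\<close> at \<open>b + t * (b - a)\<close> is at least \<open>A * g n t\<close> for all
  \<open>t \<ge> 0\<close> (\<open>funpow_hl_max_right_of_interval\<close>). The recursion that defines \<open>g\<close> is
  the induction step of this bound. At \<open>t = 0\<close> the bound gives \<open>\<gamma> * A \<le> M\<^sup>n h b \<le> c\<close>, because \<open>b\<close> is not in \<open>U\<close>.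
  Multiplication by \<open>b - a\<close> and summation over the components yields the inequality.

  By a differentiation theorem \<open>h \<le> M h\<close> almost everywhere (\<open>AE_le_hl_max\<close>), hence \<open>h \<le> M\<^sup>n h\<close>, and
  \<open>U\<close> contains \<open>{h > c}\<close> up to a null set. So the integral of \<open>h\<close> over \<open>{h > c}\<close>, times \<open>\<gamma>\<close>, is at
  most \<open>c * |{M\<^sup>n h > c}|\<close>. Integrating this against \<open>p * c powr (p - 2)\<close> over \<open>c > 0\<close>
  (\<open>nn_integral_layer_cake\<close>) turns the right-hand side into the \<open>p\<close>-th moment of \<open>M\<^sup>n h\<close> and the
  left-hand side into \<open>\<gamma> * p / (p - 1)\<close> times the \<open>p\<close>-th moment of \<open>h\<close>. All of this takes place for Borel
  functions with values in \<^typ>\<open>ennreal\<close>; \<open>f\<close> is first replaced by a Borel function that is equal to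
  it almost everywhere.\<close>

section \<open>The maximal operator\<close>

lemma hl_max_lborel:
  "hl_max h x = (SUP r\<in>{0<..}. ennreal (1 / (2 * r)) * (\<integral>\<^sup>+y\<in>{x - r..x + r}. h y \<partial>lborel))"
  by (simp add: hl_max_def nn_integral_completion)

lemma hl_max_ge_average:
  assumes "r > 0"
  shows "ennreal (1 / (2 * r)) * (\<integral>\<^sup>+y\<in>{x - r..x + r}. h y \<partial>lborel) \<le> hl_max h x"
  unfolding hl_max_lborel by (rule SUP_upper) (use assms in auto)

lemma hl_max_mono_AE:
  assumes "AE y in lborel. h y \<le> k y"
  shows "hl_max h x \<le> hl_max k x"
proof -
  have "(\<integral>\<^sup>+y\<in>A. h y \<partial>lborel) \<le> (\<integral>\<^sup>+y\<in>A. k y \<partial>lborel)" for A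
    by (rule nn_integral_mono_AE, rule eventually_mono[OF assms]) (rule mult_right_mono, simp_all)
  then show ?thesis
    unfolding hl_max_lborel by (intro SUP_mono' mult_left_mono) simp_all
qed

lemma hl_max_cong_AE:
  assumes "AE y in lborel. h y = k y"
  shows "hl_max h = hl_max k"
proof
  fix x
  have "AE y in lborel. h y \<le> k y" "AE y in lborel. k y \<le> h y"
    using assms by auto
  then show "hl_max h x = hl_max k x"
    by (intro antisym hl_max_mono_AE)
qed

text \<open>If the integral over \<open>[x - r, x + r]\<close> divided by \<open>2 * r\<close> exceeds \<open>c\<close>, then so does the same
  integral divided by \<open>2 * s\<close> for some \<open>s > r\<close>, and every point \<open>y\<close> within \<open>s - r\<close> of \<open>x\<close> has \<open>[x - r, x + r] \<subseteq> [y - s, y + s]\<close>.\<close>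

lemma open_superlevel_hl_max: "open {x. c < hl_max h x}"
  unfolding open_dist
proof (intro ballI)
  fix x assume "x \<in> {x. c < hl_max h x}"
  then have "c < hl_max h x" by simp
  then obtain r where "r \<in> {0<..}" and
    c: "c < ennreal (1 / (2 * r)) * (\<integral>\<^sup>+y\<in>{x - r..x + r}. h y \<partial>lborel)"
    unfolding hl_max_lborel less_SUP_iff by blast
  then have r: "r > 0" by simp
  define K where "K = (\<integral>\<^sup>+y\<in>{x - r..x + r}. h y \<partial>lborel)"
  have "\<exists>s>r. c < ennreal (1 / (2 * s)) * K"
  proof (cases "K = \<infinity>")
    case True
    have "ennreal (1 / (2 * (r + 1))) * K = \<infinity>"
      using r True by (simp add: ennreal_mult_top)
    moreover have "c < \<infinity>" using c by (auto intro: order_less_le_trans)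
    ultimately show ?thesis by (intro exI[of _ "r + 1"]) (simp del: infinity_ennreal_def)
  next
    case False
    have "((\<lambda>s. ennreal (1 / (2 * s)) * K) \<longlongrightarrow> ennreal (1 / (2 * r)) * K) (at_right r)"
      using r False
      by (intro tendsto_intros tendsto_mult_ennreal tendsto_ennrealI) auto
    then have "\<forall>\<^sub>F s in at_right r. c < ennreal (1 / (2 * s)) * K"
      using c unfolding K_def by (rule order_tendstoD)
    then have "\<forall>\<^sub>F s in at_right r. r < s \<and> c < ennreal (1 / (2 * s)) * K"
      using eventually_at_right_less by (rule eventually_conj[rotated])
    then show ?thesis
      by (auto dest: eventually_happens'[OF trivial_limit_at_right_real])
  qed
  then obtain s where s: "s > r" "c < ennreal (1 / (2 * s)) * K" by blast
  show "\<exists>e>0. \<forall>y. dist y x < e \<longrightarrow> y \<in> {z. c < hl_max h z}"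
  proof (intro exI conjI allI impI)
    show "s - r > 0" using s by simp
    fix y assume y: "dist y x < s - r"
    have "K \<le> (\<integral>\<^sup>+z\<in>{y - s..y + s}. h z \<partial>lborel)"
      unfolding K_def by (rule nn_set_integral_set_mono) (use y in \<open>auto simp: dist_real_def\<close>)
    then have "ennreal (1 / (2 * s)) * K \<le> ennreal (1 / (2 * s)) * (\<integral>\<^sup>+z\<in>{y - s..y + s}. h z \<partial>lborel)"
      by (rule mult_left_mono) simp
    also have "\<dots> \<le> hl_max h y"
      using r s by (intro hl_max_ge_average) simp
    finally have "ennreal (1 / (2 * s)) * K \<le> hl_max h y" .
    with s show "y \<in> {z. c < hl_max h z}" by simp
  qed
qed

lemma borel_measurable_hl_max [measurable]: "hl_max h \<in> borel_measurable borel"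
  by (rule borel_measurableI_greater) (simp add: open_superlevel_hl_max)

section \<open>Differentiation: a function lies below its maximal function\<close>

text \<open>Both sides are values of measures, namely of densities with respect to \<^term>\<open>lborel\<close>, so the
  inequality is inherited by countable disjoint unions. It serves both for the intervals of a
  Vitali covering and for the components of a superlevel set.\<close>

lemma set_nn_integral_le_emeasure_UN:
  fixes X :: "'i \<Rightarrow> real set" and h :: "real \<Rightarrow> ennreal"
  assumes "countable I" "disjoint_family_on X I"
    and [measurable]: "h \<in> borel_measurable borel" "\<And>i. i \<in> I \<Longrightarrow> X i \<in> sets borel"
    and le: "\<And>i. i \<in> I \<Longrightarrow> c * (\<integral>\<^sup>+x\<in>X i. h x \<partial>lborel) \<le> d * emeasure lborel (X i)"
  shows "c * (\<integral>\<^sup>+x\<in>\<Union>(X ` I). h x \<partial>lborel) \<le> d * emeasure lborel (\<Union>(X ` I))"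
proof -
  have *: "(\<integral>\<^sup>+x\<in>\<Union>(X ` I). h x \<partial>lborel) = (\<integral>\<^sup>+i. (\<integral>\<^sup>+x\<in>X i. h x \<partial>lborel) \<partial>count_space I)"
  proof -
    have [measurable]: "\<Union>(X ` I) \<in> sets borel"
      using assms(1) by (intro sets.countable_UN') auto
    have "(\<integral>\<^sup>+x\<in>\<Union>(X ` I). h x \<partial>lborel) = emeasure (density lborel h) (\<Union>(X ` I))"
      by (simp add: emeasure_density)
    also have "\<dots> = (\<integral>\<^sup>+i. emeasure (density lborel h) (X i) \<partial>count_space I)"
      using assms(1,2) by (intro emeasure_UN_countable) auto
    also have "\<dots> = (\<integral>\<^sup>+i. (\<integral>\<^sup>+x\<in>X i. h x \<partial>lborel) \<partial>count_space I)"
      by (intro nn_integral_cong) (simp add: emeasure_density)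
    finally show ?thesis .
  qed
  have **: "emeasure lborel (\<Union>(X ` I)) = (\<integral>\<^sup>+i. emeasure lborel (X i) \<partial>count_space I)"
    using assms(1,2) by (intro emeasure_UN_countable) auto
  show ?thesis
    unfolding * ** by (subst (1 2) nn_integral_cmult[symmetric]) (auto intro!: nn_integral_mono le)
qed

text \<open>Call the set \<open>B\<close>. Every interval centred in \<open>B\<close> has average at most \<open>q\<^sub>1\<close>. Vitali's theorem covers
  \<open>B\<close> up to a null set by disjoint such intervals inside an open \<open>T \<supseteq> B\<close> with \<open>|T| \<le> |B| + e\<close>. Hence
  \<open>q\<^sub>2 |B|\<close> is at most the integral of \<open>h\<close> over these intervals, which is at most \<open>q\<^sub>1 (|B| + e)\<close>, and
  letting \<open>e\<close> tend to \<open>0\<close> forces \<open>|B| = 0\<close>. The restriction to \<open>[-k, k]\<close> makes \<open>|B|\<close> finite.\<close>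

lemma null_set_hl_max_gap:
  fixes h :: "real \<Rightarrow> ennreal" and q\<^sub>1 q\<^sub>2 k :: real
  assumes [measurable]: "h \<in> borel_measurable borel" and q: "0 \<le> q\<^sub>1" "q\<^sub>1 < q\<^sub>2"
  shows "{x \<in> {-k..k}. hl_max h x \<le> q\<^sub>1 \<and> q\<^sub>2 \<le> h x} \<in> null_sets lborel"
proof -
  define B where "B = {x \<in> {-k..k}. hl_max h x \<le> q\<^sub>1 \<and> q\<^sub>2 \<le> h x}"
  have [measurable]: "B \<in> sets borel"
    unfolding B_def by measurable
  have "emeasure lborel B \<le> emeasure lborel {-k..k}"
    by (rule emeasure_mono) (auto simp: B_def)
  then have "emeasure lborel B < \<infinity>"
    by (rule order_le_less_trans) (simp add: emeasure_lborel_Icc_eq)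
  then obtain m where m: "m \<ge> 0" "emeasure lborel B = ennreal m"
    by (cases "emeasure lborel B") auto
  have main: "q\<^sub>2 * m \<le> q\<^sub>1 * (m + e)" if "e > 0" for e
  proof -
    obtain T where T: "open T" "B \<subseteq> T" "emeasure lborel (T - B) < ennreal e"
      using outer_regular_lborel[OF _ \<open>e > 0\<close>, of B] by auto
    have [measurable]: "T \<in> sets borel" using T by simp
    define K where "K = {(x, r). x \<in> B \<and> 0 < r \<and> cball x r \<subseteq> T}"
    define X where "X i = cball (fst i) (snd i)" for i :: "real \<times> real"
    have K_pos: "0 < snd i" if "i \<in> K" for i
      using that by (auto simp: K_def)
    have K_fine: "\<exists>i. i \<in> K \<and> x \<in> cball (fst i) (snd i) \<and> snd i < d" if "x \<in> B" "0 < d" for x d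
    proof -
      have "x \<in> T" using T that by (simp add: subset_iff)
      with T(1) have "\<exists>s>0. cball x s \<subseteq> T"
        unfolding open_contains_cball by (rule bspec)
      then obtain s where s: "s > 0" "cball x s \<subseteq> T" by (elim exE conjE)
      define r where "r = min s (d / 2)"
      have "r > 0" "r < d" "cball x r \<subseteq> cball x s"
        using s that by (auto simp: r_def)
      then have "(x, r) \<in> K" "x \<in> cball x r" "r < d"
        using s that unfolding K_def by (simp_all add: order_trans)
      then show ?thesis
        by (intro exI[of _ "(x, r)"]) simp
    qed
    obtain C where C: "countable C" "C \<subseteq> K"
      "pairwise (\<lambda>i j. disjnt (cball (fst i) (snd i)) (cball (fst j) (snd j))) C"
      and neg: "negligible (B - (\<Union>i\<in>C. cball (fst i) (snd i)))"
      by (rule Vitali_covering_theorem_cballs[of K snd B fst, OF K_pos K_fine])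
    have disj: "disjoint_family_on X C"
      using C(3) by (auto simp: disjoint_family_on_def pairwise_def disjnt_def X_def)
    have [measurable]: "X i \<in> sets borel" for i
      by (simp add: X_def)
    have [measurable]: "\<Union>(X ` C) \<in> sets borel"
      using C(1) by (intro sets.countable_UN') auto
    have "1 * (\<integral>\<^sup>+y\<in>\<Union>(X ` C). h y \<partial>lborel) \<le> ennreal q\<^sub>1 * emeasure lborel (\<Union>(X ` C))"
    proof (rule set_nn_integral_le_emeasure_UN[OF C(1) disj])
      fix i assume "i \<in> C"
      with C(2) obtain x r where i: "i = (x, r)" "x \<in> B" "r > 0" by (auto simp: K_def)
      have X: "X i = {x - r..x + r}" by (auto simp: X_def i dist_real_def)
      define I where "I = (\<integral>\<^sup>+y\<in>{x - r..x + r}. h y \<partial>lborel)"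
      have "ennreal (1 / (2 * r)) * I \<le> ennreal q\<^sub>1"
        using hl_max_ge_average[of r h x] i by (auto simp: B_def I_def)
      then have "ennreal (2 * r) * (ennreal (1 / (2 * r)) * I) \<le> ennreal (2 * r) * ennreal q\<^sub>1"
        by (rule mult_left_mono) simp
      then show "1 * (\<integral>\<^sup>+y\<in>X i. h y \<partial>lborel) \<le> ennreal q\<^sub>1 * emeasure lborel (X i)"
        using i(3) by (simp add: X I_def mult.assoc[symmetric] ennreal_mult[symmetric] mult.commute)
    qed auto
    moreover have "ennreal q\<^sub>2 * emeasure lborel B \<le> (\<integral>\<^sup>+y\<in>\<Union>(X ` C). h y \<partial>lborel)"
    proof -
      have "AE y in lborel. y \<notin> B - \<Union>(X ` C)"
        using neg unfolding negligible_iff_null_sets X_def[symmetric]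
        by (intro AE_not_in) (simp add: null_sets_completion_iff)
      then have "(\<integral>\<^sup>+y. ennreal q\<^sub>2 * indicator B y \<partial>lborel) \<le> (\<integral>\<^sup>+y\<in>\<Union>(X ` C). h y \<partial>lborel)"
        by (intro nn_integral_mono_AE, elim eventually_mono)
           (auto simp: B_def split: split_indicator)
      then show ?thesis
        by (simp add: nn_integral_cmult_indicator)
    qed
    moreover have "emeasure lborel (\<Union>(X ` C)) \<le> emeasure lborel T"
    proof (intro emeasure_mono UN_least)
      show "X i \<subseteq> T" if "i \<in> C" for i
        using subsetD[OF C(2) that] by (simp add: X_def K_def split_beta)
    qed simp
    moreover have "emeasure lborel T \<le> ennreal (m + e)"
    proof -
      have "emeasure lborel T = emeasure lborel B + emeasure lborel (T - B)"
        using T(2) by (subst plus_emeasure) (auto intro!: arg_cong[where f = "emeasure lborel"])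
      also have "\<dots> \<le> ennreal m + ennreal e"
        unfolding m(2) by (rule add_left_mono) (use T(3) in simp)
      finally show ?thesis using m that by (simp add: ennreal_plus)
    qed
    ultimately have "ennreal q\<^sub>2 * ennreal m \<le> ennreal q\<^sub>1 * ennreal (m + e)"
      unfolding m(2) mult_1 by (meson mult_left_mono order_trans zero_le)
    then show ?thesis
      using q m that by (simp add: ennreal_mult[symmetric] del: ennreal_plus)
  qed
  have "m = 0"
  proof (rule ccontr)
    assume "m \<noteq> 0"
    then have "m > 0" using m by simp
    \<comment> \<open>for this \<open>e\<close> the bound on \<open>q\<^sub>2 * m\<close> fails by exactly \<open>e\<close>\<close>
    define e where "e = (q\<^sub>2 - q\<^sub>1) * m / (q\<^sub>1 + 1)"
    have "e > 0" using q \<open>m > 0\<close> by (simp add: e_def)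
    moreover have "e * (q\<^sub>1 + 1) = (q\<^sub>2 - q\<^sub>1) * m"
      using q by (simp add: e_def)
    ultimately show False
      using main[of e] by (simp add: algebra_simps)
  qed
  then have "B \<in> null_sets lborel"
    using m by (simp add: null_sets_def)
  then show ?thesis unfolding B_def .
qed

text \<open>Wherever \<open>h\<close> exceeds its maximal function, a pair of rationals separates the two values, so the
  exceptional set is a countable union of the null sets above.\<close>

lemma AE_le_hl_max:
  assumes [measurable]: "h \<in> borel_measurable borel"
  shows "AE x in lborel. h x \<le> hl_max h x"
proof -
  have "AE x in lborel. \<forall>k::nat. \<forall>q\<^sub>1 q\<^sub>2 :: rat. 0 \<le> q\<^sub>1 \<longrightarrow> q\<^sub>1 < q\<^sub>2 \<longrightarrow>
          x \<notin> {x \<in> {-real k..real k}. hl_max h x \<le> real_of_rat q\<^sub>1 \<and> real_of_rat q\<^sub>2 \<le> h x}"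
    unfolding AE_all_countable
    by (intro allI impI AE_impI AE_not_in null_set_hl_max_gap) (auto simp: of_rat_less)
  then show ?thesis
  proof (rule eventually_mono)
    fix x
    assume *: "\<forall>k::nat. \<forall>q\<^sub>1 q\<^sub>2 :: rat. 0 \<le> q\<^sub>1 \<longrightarrow> q\<^sub>1 < q\<^sub>2 \<longrightarrow>
          x \<notin> {x \<in> {-real k..real k}. hl_max h x \<le> real_of_rat q\<^sub>1 \<and> real_of_rat q\<^sub>2 \<le> h x}"
    show "h x \<le> hl_max h x"
    proof (rule ccontr)
      assume "\<not> h x \<le> hl_max h x"
      then obtain q\<^sub>1 where q1: "hl_max h x < real_of_rat q\<^sub>1" "real_of_rat q\<^sub>1 < h x"
        using ennreal_rat_dense by (meson not_le)
      then obtain q\<^sub>2 where q2: "ennreal (real_of_rat q\<^sub>1) < real_of_rat q\<^sub>2" "real_of_rat q\<^sub>2 < h x"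
        using ennreal_rat_dense by meson
      have "0 < ennreal (real_of_rat q\<^sub>1)" 
        using q1(1) by (rule le_less_trans[rotated]) simp
      then have "0 \<le> q\<^sub>1" by simp
      moreover have "q\<^sub>1 < q\<^sub>2" using q2(1) \<open>0 \<le> q\<^sub>1\<close> by (simp add: ennreal_less_iff of_rat_less)
      moreover obtain k :: nat where "\<bar>x\<bar> \<le> real k" using real_arch_simple by blast
      then have "x \<in> {-real k..real k}" by auto
      ultimately show False 
        using *[rule_format, of q\<^sub>1 q\<^sub>2 k] q1(1) q2(2) by (simp add: less_imp_le)
    qed
  qed
qed

section \<open>Propagation to the right of an interval\<close>

lemma continuous_on_g: "continuous_on {0..c} (g n)"
proof (induction n arbitrary: c)
  case (Suc n)
  have "(g n) integrable_on {0..1 + 2 * c}"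
    by (intro integrable_continuous_real Suc)
  then have *: "continuous_on {0..1 + 2 * c} (\<lambda>x. integral {0..x} (g n))"
    by (rule indefinite_integral_continuous_1)
  have "continuous_on {0..c} (\<lambda>t. integral {0..1 + 2 * t} (g n))"
    by (rule continuous_on_compose2[OF *]) (auto intro!: continuous_intros)
  then show ?case
    by (auto intro!: continuous_intros)
qed simp

lemma g_nonneg: "t \<ge> 0 \<Longrightarrow> g n t \<ge> 0"
proof (induction n arbitrary: t)
  case (Suc n)
  then have "integral {0..1 + 2 * t} (g n) \<ge> 0"
    by (intro integral_nonneg integrable_continuous_real continuous_on_g) auto
  with Suc.prems show ?case by simp
qed simp

lemma borel_measurable_funpow_hl_max [measurable]:
  "h \<in> borel_measurable borel \<Longrightarrow> (hl_max ^^ n) h \<in> borel_measurable borel"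
  by (cases n) auto

lemma AE_le_funpow_hl_max:
  assumes "h \<in> borel_measurable borel"
  shows "AE x in lborel. h x \<le> (hl_max ^^ n) h x"
proof (induction n)
  case (Suc n)
  then have "hl_max h x \<le> (hl_max ^^ Suc n) h x" for x
    by (simp add: hl_max_mono_AE)
  then show ?case
    using AE_le_hl_max[OF assms] by (auto elim!: eventually_mono intro: order_trans)
qed simp

text \<open>The substitution \<open>u = (y - b) / (b - a)\<close>, which carries the normalised picture, with \<open>[-1, 0]\<close> in
  place of \<open>[a, b]\<close>, to a general interval.\<close>

lemma has_integral_g_rescaled:
  assumes "a < b" "t \<ge> 0"
  shows "((\<lambda>y. g n ((y - b) / (b - a)) / (b - a)) has_integral integral {0..1 + 2 * t} (g n))
           {b..b + (1 + 2 * t) * (b - a)}"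
proof -
  define L where "L = b - a"
  have L: "L > 0" using assms by (simp add: L_def)
  define J where "J = integral {0..1 + 2 * t} (g n)"
  have "(g n has_integral J) (cbox 0 (1 + 2 * t))"
    unfolding cbox_interval J_def by (intro integrable_integral integrable_continuous_real continuous_on_g)
  then have "((\<lambda>y. g n ((1 / L) *\<^sub>R y + - (b / L)) / L) has_integral (J /\<^sub>R (1 / L) ^ DIM(real)) / L)
      (cbox ((0 - - (b / L)) /\<^sub>R (1 / L)) ((1 + 2 * t - - (b / L)) /\<^sub>R (1 / L)))"
    using L by (intro has_integral_divide has_integral_affinity') simp_all
  moreover have "(1 / L) *\<^sub>R y + - (b / L) = (y - b) / L" for y
    by (simp add: diff_divide_distrib)
  moreover have "(J /\<^sub>R (1 / L) ^ DIM(real)) / L = J" "(0 - - (b / L)) /\<^sub>R (1 / L) = b"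
    using L by simp_all
  moreover have "(1 + 2 * t - - (b / L)) /\<^sub>R (1 / L) = b + (1 + 2 * t) * L"
    using L by (simp add: distrib_left distrib_right)
  ultimately show ?thesis
    unfolding L_def[symmetric] J_def[symmetric] by (simp only: cbox_interval)
qed

text \<open>This is where the recursion for \<open>g\<close> comes from. Put \<open>L = b - a\<close>. The interval centred at
  \<open>b + t * L\<close> whose left end is \<open>a\<close> is \<open>[a, b + (1 + 2 * t) * L]\<close>. On its part \<open>[a, b]\<close> the iterate
  \<open>(hl_max ^^ n) h\<close> is at least \<open>h\<close>; on the rest it is, by induction, at least a rescaled \<open>g n\<close> times
  the average of \<open>h\<close> over \<open>[a, b]\<close>. Adding the two contributions and dividing by the length
  \<open>2 * (1 + t) * L\<close> gives the same bound with \<open>g (Suc n) t\<close>.\<close>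

lemma funpow_hl_max_right_of_interval:
  assumes [measurable]: "h \<in> borel_measurable borel" and "a < b" "t \<ge> 0"
  shows "(\<integral>\<^sup>+y\<in>{a..b}. h y \<partial>lborel) * ennreal (g n t / (b - a)) \<le> (hl_max ^^ n) h (b + t * (b - a))"
  using \<open>t \<ge> 0\<close>
proof (induction n arbitrary: t)
  case (Suc n)
  define L where "L = b - a"
  define I where "I = (\<integral>\<^sup>+y\<in>{a..b}. h y \<partial>lborel)"
  define H where "H = (hl_max ^^ n) h"
  define c where "c = b + (1 + 2 * t) * L"
  define \<phi> where "\<phi> = (\<lambda>y. g n ((y - b) / L) / L)"
  define J where "J = integral {0..1 + 2 * t} (g n)"
  have L: "L > 0" using \<open>a < b\<close> by (simp add: L_def)
  have J: "J \<ge> 0"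
    unfolding J_def by (intro integral_nonneg integrable_continuous_real continuous_on_g g_nonneg) auto
  have phi_nonneg: "0 \<le> \<phi> y" if "b \<le> y" for y
    unfolding \<phi>_def using L that by (intro divide_nonneg_pos g_nonneg) auto
  have phi_int: "(\<phi> has_integral J) {b..c}"
    unfolding \<phi>_def J_def c_def L_def using \<open>a < b\<close> \<open>t \<ge> 0\<close> by (rule has_integral_g_rescaled)
  have "continuous_on {b..c} \<phi>"
    unfolding \<phi>_def
    by (intro continuous_intros continuous_on_compose2[OF continuous_on_g[of "(c - b) / L"]])
       (use L in \<open>auto intro!: divide_right_mono\<close>)
  then have [measurable]: "(\<lambda>y. indicator {b..c} y * \<phi> y) \<in> borel_measurable borel"
    using borel_measurable_continuous_on_indicator[of "{b..c}" \<phi>] by simp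
  have [measurable]: "H \<in> borel_measurable borel"
    unfolding H_def by simp

  have "I * ennreal (1 + J) = I + I * ennreal J"
    using J by (simp add: distrib_left)
  also have "ennreal J = (\<integral>\<^sup>+y. ennreal (\<phi> y) * indicator {b..c} y \<partial>lborel)"
    using phi_nonneg phi_int by (intro nn_integral_has_integral_lebesgue'[symmetric]) auto
  also have "\<dots> = (\<integral>\<^sup>+y. ennreal (indicator {b..c} y * \<phi> y) \<partial>lborel)"
    by (intro nn_integral_cong) (simp split: split_indicator)
  also have "I + I * \<dots> = (\<integral>\<^sup>+y. h y * indicator {a..b} y + I * ennreal (indicator {b..c} y * \<phi> y) \<partial>lborel)"
    unfolding I_def by (subst nn_integral_add) (auto simp: nn_integral_cmult)
  also have "\<dots> \<le> (\<integral>\<^sup>+y\<in>{a..c}. H y \<partial>lborel)"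
  proof (rule nn_integral_mono_AE)
    have phi_le: "I * ennreal (\<phi> y) \<le> H y" if "b \<le> y" for y
    proof -
      have "(y - b) / L \<ge> 0" using L that by simp
      from Suc.IH[OF this] L show ?thesis
        by (simp add: I_def H_def \<phi>_def L_def)
    qed
    have "b \<le> c" using L Suc.prems by (simp add: c_def)
    show "AE y in lborel. h y * indicator {a..b} y + I * ennreal (indicator {b..c} y * \<phi> y)
            \<le> H y * indicator {a..c} y"
      using AE_le_funpow_hl_max[OF assms(1), of n, folded H_def] AE_lborel_singleton[of b]
      by eventually_elim (use \<open>a < b\<close> \<open>b \<le> c\<close> phi_le in \<open>auto split: split_indicator\<close>)
  qed
  finally have 1: "I * ennreal (1 + J) \<le> (\<integral>\<^sup>+y\<in>{a..c}. H y \<partial>lborel)" .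

  define r where "r = (1 + t) * L"
  have "r > 0"
    using L Suc.prems by (simp add: r_def)
  moreover have "b + t * L - r = a" "b + t * L + r = c"
    by (simp_all add: r_def c_def L_def algebra_simps)
  ultimately have r: "r > 0" "b + t * L - r = a" "b + t * L + r = c" .
  have "I * ennreal (g (Suc n) t / L) = ennreal (1 / (2 * r)) * (I * ennreal (1 + J))"
  proof -
    have "g (Suc n) t / L = 1 / (2 * r) * (1 + J)"
      using L Suc.prems by (simp add: r_def J_def field_simps)
    moreover have "ennreal (1 / (2 * r) * (1 + J)) = ennreal (1 / (2 * r)) * ennreal (1 + J)"
      by (rule ennreal_mult) (use J r(1) in simp_all)
    ultimately show ?thesis
      by (simp only: mult.left_commute)
  qed
  also have "\<dots> \<le> ennreal (1 / (2 * r)) * (\<integral>\<^sup>+y\<in>{a..c}. H y \<partial>lborel)"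
    by (rule mult_left_mono[OF 1]) simp
  also have "\<dots> \<le> hl_max H (b + t * L)"
    using hl_max_ge_average[OF r(1), of H "b + t * L"] unfolding r(2,3) .
  finally show ?case
    by (simp add: I_def H_def L_def)
qed simp

section \<open>Lower bound for the measure of superlevel sets\<close>

text \<open>A component of finite measure is bounded, since it contains the segment between any two of its
  points. If \<open>b\<close> were in \<open>U\<close>, the connected set \<open>{a<..b}\<close> would enlarge the component.\<close>

lemma component_open_real_finite_measure:
  fixes U J :: "real set"
  assumes "open U" "emeasure lborel U < \<infinity>" "J \<in> components U"
  obtains a b where "a < b" "J = {a<..<b}" "b \<notin> U"
proof -
  have J: "open J" "connected J" "J \<noteq> {}" "J \<subseteq> U"
    using assms(1,3) in_components_connected[OF assms(3)] in_components_nonempty[OF assms(3)]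
      in_components_subset[OF assms(3)]
    by (auto simp: components_iff open_connected_component)
  obtain m where m: "emeasure lborel U = ennreal m" "m \<ge> 0"
    using assms(2) by (cases "emeasure lborel U") auto
  have dist_le: "y - x \<le> m" if "x \<in> J" "y \<in> J" "x \<le> y" for x y
  proof -
    have "emeasure lborel {x..y} \<le> emeasure lborel U"
      using connected_contains_Icc[OF J(2) that(1,2)] J(4) assms(1) by (intro emeasure_mono) auto
    then show ?thesis using m that by simp
  qed
  obtain x\<^sub>0 where x0: "x\<^sub>0 \<in> J" using J by auto
  have bounds: "x\<^sub>0 - m \<le> y \<and> y \<le> x\<^sub>0 + m" if "y \<in> J" for y
    using dist_le[OF x0 that] dist_le[OF that x0] m by (cases "y \<le> x\<^sub>0") auto
  obtain a b where J_eq: "J = {a<..<b}"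
  proof -
    obtain a b where "J = {} \<or> J = UNIV \<or> J = {..<b} \<or> J = {..b} \<or> J = {a<..} \<or> J = {a..} \<or>
        J = {a<..<b} \<or> J = {a<..b} \<or> J = {a..<b} \<or> J = {a..b}"
      using is_real_interval[of J] J(2) by (auto simp: is_interval_connected_1)
    moreover have "J \<noteq> UNIV" using bounds[of "x\<^sub>0 + m + 1"] m(2) by auto
    moreover have "J \<noteq> {..<b}" "J \<noteq> {..b}" using bounds[of "x\<^sub>0 - m - 1"] x0 m(2) by auto
    moreover have "J \<noteq> {a<..}" "J \<noteq> {a..}" using bounds[of "x\<^sub>0 + m + 1"] x0 m(2) by auto
    ultimately have "J = {a<..<b} \<or> J = {a<..b} \<or> J = {a..<b} \<or> J = {a..b}"
      using J(3) by blast
    then have "interior J = {a<..<b}"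
      by (elim disjE) simp_all
    then show ?thesis
      using interior_open[OF J(1)] by (intro that) simp
  qed
  have "a < b" using J_eq J(3) by simp
  have "b \<notin> U"
  proof
    assume "b \<in> U"
    have "{a<..b} = insert b J"
      using \<open>a < b\<close> unfolding J_eq by auto
    then have "{a<..b} \<subseteq> U" "J \<inter> {a<..b} \<noteq> {}"
      using \<open>b \<in> U\<close> J(3,4) by auto
    then have "{a<..b} \<subseteq> J"
      by (intro components_maximal[OF assms(3)] connected_Ioc)
    then show False using J_eq \<open>a < b\<close> by auto
  qed
  then show ?thesis using \<open>a < b\<close> J_eq by (rule that[rotated 2])
qed

text \<open>The heart of the proof. It suffices to treat each component \<open>(a, b)\<close> of the open set \<open>U\<close>. Its right
  endpoint lies outside \<open>U\<close>, so the iterate is at most \<open>c\<close> there; by the propagation lemma with \<open>t = 0\<close>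
  it is at least \<open>gamma_seq n\<close> times the average of \<open>h\<close> over \<open>(a, b)\<close>. If \<open>U\<close> has infinite measure, so
  that unbounded components may occur, the right-hand side is infinite.\<close>

lemma measure_superlevel_funpow_hl_max_ge:
  fixes c :: real
  assumes [measurable]: "h \<in> borel_measurable borel" and "n \<ge> 1" "c > 0"
  defines "U \<equiv> {x. c < (hl_max ^^ n) h x}"
  shows "ennreal (gamma_seq n) * (\<integral>\<^sup>+x\<in>U. h x \<partial>lborel) \<le> c * emeasure lborel U"
proof (cases "emeasure lborel U = \<infinity>")
  case True
  with \<open>c > 0\<close> show ?thesis by (simp add: ennreal_mult_top)
next
  case False
  obtain k where "n = Suc k" using \<open>n \<ge> 1\<close> by (cases n) auto
  then have "open U" by (simp add: U_def open_superlevel_hl_max)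
  have open_comp: "open J" if "J \<in> components U" for J
    using that \<open>open U\<close> by (auto simp: components_iff open_connected_component)
  have "countable (components U)"
    using open_comp pairwise_disjoint_components[of U]
    by (intro countable_disjoint_open_subsets) (auto simp: pairwise_def disjnt_def)
  moreover have "disjoint_family_on (\<lambda>J. J) (components U)"
    using pairwise_disjoint_components[of U] by (auto simp: pairwise_def disjoint_family_on_def)
  ultimately have "ennreal (gamma_seq n) * (\<integral>\<^sup>+x\<in>\<Union>((\<lambda>J. J) ` components U). h x \<partial>lborel)
                    \<le> c * emeasure lborel (\<Union>((\<lambda>J. J) ` components U))"
  proof (rule set_nn_integral_le_emeasure_UN)
    fix J assume "J \<in> components U"
    with \<open>open U\<close> False obtain a b where J: "a < b" "J = {a<..<b}" "b \<notin> U"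
      by (elim component_open_real_finite_measure[rotated 2]) (auto simp: top.not_eq_extremum)
    have "(\<integral>\<^sup>+y\<in>{a..b}. h y \<partial>lborel) * ennreal (gamma_seq n / (b - a)) \<le> (hl_max ^^ n) h b"
      using funpow_hl_max_right_of_interval[of h a b 0 n] J by (simp add: gamma_seq_def)
    also have "\<dots> \<le> c"
      using J(3) by (simp add: U_def)
    finally have "(\<integral>\<^sup>+y\<in>{a..b}. h y \<partial>lborel) * ennreal (gamma_seq n / (b - a)) * ennreal (b - a) \<le> c * ennreal (b - a)"
      by (rule mult_right_mono) simp
    also have "(\<integral>\<^sup>+y\<in>{a..b}. h y \<partial>lborel) * ennreal (gamma_seq n / (b - a)) * ennreal (b - a)
        = ennreal (gamma_seq n) * (\<integral>\<^sup>+y\<in>{a..b}. h y \<partial>lborel)"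
      using J(1) g_nonneg[of 0 n]
      by (simp add: mult.assoc ennreal_mult[symmetric] gamma_seq_def) (simp add: mult.commute)
    also have "(\<integral>\<^sup>+y\<in>{a..b}. h y \<partial>lborel) = (\<integral>\<^sup>+y\<in>J. h y \<partial>lborel)"
      using AE_lborel_singleton[of a] AE_lborel_singleton[of b] unfolding J(2)
      by (intro nn_integral_cong_AE, eventually_elim) (auto split: split_indicator)
    finally show "ennreal (gamma_seq n) * (\<integral>\<^sup>+y\<in>J. h y \<partial>lborel) \<le> c * emeasure lborel J"
      using J by simp
  qed (use open_comp in auto)
  then show ?thesis by simp
qed

section \<open>Integration over levels\<close>

lemma nn_integral_powr_below:
  assumes "q > 0"
  shows "(\<integral>\<^sup>+l. ennreal (q * l powr (q - 1)) * indicator {l. 0 < l \<and> ennreal l < c} l \<partial>lborel) = ennreal_rpow c q"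
proof -
  have fin: "(\<integral>\<^sup>+l. ennreal (q * l powr (q - 1)) * indicator {0<..<s} l \<partial>lborel) = ennreal (s powr q)"
    if "s \<ge> 0" for s
  proof -
    have "((\<lambda>l. q * l powr (q - 1)) has_integral q * (s powr (q - 1 + 1) / (q - 1 + 1))) {0..s}"
      using assms that by (intro has_integral_mult_right has_integral_powr_from_0) auto
    then have "((\<lambda>l. q * l powr (q - 1)) has_integral s powr q) {0..s}"
      using assms by simp
    then have "(\<integral>\<^sup>+l. ennreal (q * l powr (q - 1)) * indicator {0..s} l \<partial>lborel) = ennreal (s powr q)"
      using assms by (intro nn_integral_has_integral_lebesgue') auto
    moreover have "(\<integral>\<^sup>+l. ennreal (q * l powr (q - 1)) * indicator {0<..<s} l \<partial>lborel)
        = (\<integral>\<^sup>+l. ennreal (q * l powr (q - 1)) * indicator {0..s} l \<partial>lborel)"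
      using AE_lborel_singleton[of 0] AE_lborel_singleton[of s]
      by (intro nn_integral_cong_AE, eventually_elim) (auto split: split_indicator)
    ultimately show ?thesis by simp
  qed
  show ?thesis
  proof (cases c)
    case (real s)
    then have "{l. 0 < l \<and> ennreal l < c} = {0<..<s}" by (auto simp: ennreal_less_iff)
    with fin[of s] real show ?thesis by (simp add: ennreal_rpow_def)
  next
    case top
    have "ennreal s \<le> (\<integral>\<^sup>+l. ennreal (q * l powr (q - 1)) * indicator {l. 0 < l \<and> ennreal l < c} l \<partial>lborel)"
      if "s \<ge> 0" for s
    proof -
      have "ennreal s = (\<integral>\<^sup>+l. ennreal (q * l powr (q - 1)) * indicator {0<..<s powr (1 / q)} l \<partial>lborel)"
        using fin[of "s powr (1 / q)"] assms that by (simp add: powr_powr)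
      also have "\<dots> \<le> (\<integral>\<^sup>+l. ennreal (q * l powr (q - 1)) * indicator {l. 0 < l \<and> ennreal l < c} l \<partial>lborel)"
        by (intro nn_set_integral_set_mono) (auto simp: top)
      finally show ?thesis .
    qed
    \<comment> \<open>a finite integral would be exceeded by its own value plus one\<close>
    from this[of "enn2real (\<integral>\<^sup>+l. ennreal (q * l powr (q - 1)) * indicator {l. 0 < l \<and> ennreal l < c} l \<partial>lborel) + 1"]
    have "(\<integral>\<^sup>+l. ennreal (q * l powr (q - 1)) * indicator {l. 0 < l \<and> ennreal l < c} l \<partial>lborel) = top"
      by (cases "\<integral>\<^sup>+l. ennreal (q * l powr (q - 1)) * indicator {l. 0 < l \<and> ennreal l < c} l \<partial>lborel")
         (simp_all del: ennreal_plus)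
    then show ?thesis by (simp add: top ennreal_rpow_def)
  qed
qed

text \<open>The layer-cake formula with a weight \<open>w\<close>. Weight \<open>1\<close> turns measures of superlevel sets into a \<open>p\<close>-th
  moment; weight \<open>h\<close> with exponent \<open>p - 1\<close> does the same for the integrals of \<open>h\<close> over its own
  superlevel sets.\<close>

lemma nn_integral_layer_cake:
  assumes [measurable]: "h \<in> borel_measurable borel" "w \<in> borel_measurable borel" and "q > 0"
  shows "(\<integral>\<^sup>+x. w x * ennreal_rpow (h x) q \<partial>lborel)
    = (\<integral>\<^sup>+l\<in>{0<..}. ennreal (q * l powr (q - 1)) * (\<integral>\<^sup>+x\<in>{x. ennreal l < h x}. w x \<partial>lborel) \<partial>lborel)"
proof -
  have meas [measurable]: "(\<lambda>(x, l). w x * (ennreal (q * l powr (q - 1)) * indicator {l. 0 < l \<and> ennreal l < h x} l))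
      \<in> borel_measurable (lborel \<Otimes>\<^sub>M lborel)"
    unfolding indicator_def by measurable
  have "(\<integral>\<^sup>+x. w x * ennreal_rpow (h x) q \<partial>lborel)
      = (\<integral>\<^sup>+x. (\<integral>\<^sup>+l. w x * (ennreal (q * l powr (q - 1)) * indicator {l. 0 < l \<and> ennreal l < h x} l) \<partial>lborel) \<partial>lborel)"
    unfolding nn_integral_powr_below[OF \<open>q > 0\<close>, symmetric]
    by (intro nn_integral_cong nn_integral_cmult[symmetric]) (simp add: indicator_def)
  also have "\<dots> = (\<integral>\<^sup>+l. (\<integral>\<^sup>+x. w x * (ennreal (q * l powr (q - 1)) * indicator {l. 0 < l \<and> ennreal l < h x} l) \<partial>lborel) \<partial>lborel)"
    by (rule lborel_pair.Fubini'[OF meas, symmetric])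
  also have "\<dots> = (\<integral>\<^sup>+l\<in>{0<..}. ennreal (q * l powr (q - 1)) * (\<integral>\<^sup>+x\<in>{x. ennreal l < h x}. w x \<partial>lborel) \<partial>lborel)"
  proof (rule nn_integral_cong)
    fix l :: real
    have "(\<integral>\<^sup>+x. w x * (ennreal (q * l powr (q - 1)) * indicator {l. 0 < l \<and> ennreal l < h x} l) \<partial>lborel)
      = (\<integral>\<^sup>+x. (ennreal (q * l powr (q - 1)) * indicator {0<..} l) * (w x * indicator {x. ennreal l < h x} x) \<partial>lborel)"
      by (intro nn_integral_cong) (auto split: split_indicator simp: mult_ac)
    also have "\<dots> = (ennreal (q * l powr (q - 1)) * indicator {0<..} l) * (\<integral>\<^sup>+x\<in>{x. ennreal l < h x}. w x \<partial>lborel)"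
      by (intro nn_integral_cmult) simp
    finally show "(\<integral>\<^sup>+x. w x * (ennreal (q * l powr (q - 1)) * indicator {l. 0 < l \<and> ennreal l < h x} l) \<partial>lborel)
      = ennreal (q * l powr (q - 1)) * (\<integral>\<^sup>+x\<in>{x. ennreal l < h x}. w x \<partial>lborel) * indicator {0<..} l"
      by (simp add: mult_ac)
  qed
  finally show ?thesis .
qed

text \<open>For almost all points of \<open>{h > l}\<close> the iterate exceeds \<open>l\<close> as well, so the bound on superlevel sets
  remains true with the integral over \<open>{h > l}\<close>. Multiplied by \<open>p * l powr (p - 2)\<close> and integrated over
  \<open>l > 0\<close>, its right-hand side becomes the \<open>p\<close>-th moment of the iterate. Its left-hand side is a
  layer-cake integral with exponent \<open>p - 1\<close> up to the factor \<open>p / (p - 1)\<close>, which is the origin of this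
  factor in the constant.\<close>

lemma nn_integral_powr_funpow_hl_max_ge:
  assumes [measurable]: "h \<in> borel_measurable borel" and "n \<ge> 1" "p > 1"
  shows "ennreal (gamma_seq n * p / (p - 1)) * (\<integral>\<^sup>+x. ennreal_rpow (h x) p \<partial>lborel)
    \<le> (\<integral>\<^sup>+x. ennreal_rpow ((hl_max ^^ n) h x) p \<partial>lborel)"
proof -
  define H where "H = (hl_max ^^ n) h"
  have [measurable]: "H \<in> borel_measurable borel"
    by (simp add: H_def)
  have gamma: "gamma_seq n \<ge> 0"
    by (simp add: gamma_seq_def g_nonneg)
  have superlevel: "ennreal (gamma_seq n) * (\<integral>\<^sup>+x\<in>{x. ennreal l < h x}. h x \<partial>lborel)
      \<le> ennreal l * (\<integral>\<^sup>+x\<in>{x. ennreal l < H x}. 1 \<partial>lborel)" if "l > 0" for l :: real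
  proof -
    have "(\<integral>\<^sup>+x\<in>{x. ennreal l < h x}. h x \<partial>lborel) \<le> (\<integral>\<^sup>+x\<in>{x. ennreal l < H x}. h x \<partial>lborel)"
      using AE_le_funpow_hl_max[of h n] unfolding H_def[symmetric]
      by (intro nn_integral_mono_AE) (auto elim!: eventually_mono split: split_indicator intro: less_le_trans)
    then have "ennreal (gamma_seq n) * (\<integral>\<^sup>+x\<in>{x. ennreal l < h x}. h x \<partial>lborel)
        \<le> ennreal (gamma_seq n) * (\<integral>\<^sup>+x\<in>{x. ennreal l < H x}. h x \<partial>lborel)"
      by (rule mult_left_mono) simp
    also have "\<dots> \<le> ennreal l * emeasure lborel {x. ennreal l < H x}"
      unfolding H_def by (rule measure_superlevel_funpow_hl_max_ge) (use that assms in auto)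
    finally show ?thesis by simp
  qed
  have pow: "h x * ennreal_rpow (h x) (p - 1) = ennreal_rpow (h x) p" for x
  proof (cases "h x")
    case (real s)
    have "s * s powr (p - 1) = s powr p"
      using real powr_add[of s 1 "p - 1"] by (cases "s = 0") auto
    with real show ?thesis by (simp add: ennreal_rpow_def ennreal_mult[symmetric])
  qed (simp add: ennreal_rpow_def)
  have "ennreal (gamma_seq n * p / (p - 1)) * (\<integral>\<^sup>+x. ennreal_rpow (h x) p \<partial>lborel)
    = ennreal (gamma_seq n * p / (p - 1)) * (\<integral>\<^sup>+x. h x * ennreal_rpow (h x) (p - 1) \<partial>lborel)"
    by (simp add: pow)
  also have "\<dots> = ennreal (gamma_seq n * p / (p - 1)) * (\<integral>\<^sup>+l\<in>{0<..}. ennreal ((p - 1) * l powr (p - 1 - 1)) *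
      (\<integral>\<^sup>+x\<in>{x. ennreal l < h x}. h x \<partial>lborel) \<partial>lborel)"
    using \<open>p > 1\<close> by (subst nn_integral_layer_cake) auto
  also have "\<dots> = (\<integral>\<^sup>+l. ennreal (gamma_seq n * p / (p - 1)) * (ennreal ((p - 1) * l powr (p - 1 - 1)) *
      (\<integral>\<^sup>+x\<in>{x. ennreal l < h x}. h x \<partial>lborel) * indicator {0<..} l) \<partial>lborel)"
    by (rule nn_integral_cmult[symmetric]) measurable
  also have "\<dots> \<le> (\<integral>\<^sup>+l\<in>{0<..}. ennreal (p * l powr (p - 1)) * (\<integral>\<^sup>+x\<in>{x. ennreal l < H x}. 1 \<partial>lborel) \<partial>lborel)"
  proof (rule nn_integral_mono)
    fix l :: real
    define S where "S = (\<integral>\<^sup>+x\<in>{x. ennreal l < h x}. h x \<partial>lborel)"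
    define T where "T = (\<integral>\<^sup>+x\<in>{x. ennreal l < H x}. 1 \<partial>lborel)"
    show "ennreal (gamma_seq n * p / (p - 1)) * (ennreal ((p - 1) * l powr (p - 1 - 1)) * S * indicator {0<..} l)
        \<le> ennreal (p * l powr (p - 1)) * T * indicator {0<..} l"
    proof (cases "l > 0")
      case True
      have "ennreal (gamma_seq n * p / (p - 1)) * (ennreal ((p - 1) * l powr (p - 1 - 1)) * S)
          = ennreal (gamma_seq n * p / (p - 1) * ((p - 1) * l powr (p - 1 - 1))) * S"
        using gamma \<open>p > 1\<close> by (subst ennreal_mult) (auto simp: mult.assoc)
      also have "gamma_seq n * p / (p - 1) * ((p - 1) * l powr (p - 1 - 1)) = (p * l powr (p - 1 - 1)) * gamma_seq n"
        using \<open>p > 1\<close> by simp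
      also have "ennreal \<dots> * S = ennreal (p * l powr (p - 1 - 1)) * (ennreal (gamma_seq n) * S)"
        using gamma \<open>p > 1\<close> by (subst ennreal_mult) (auto simp: mult.assoc)
      also have "\<dots> \<le> ennreal (p * l powr (p - 1 - 1)) * (ennreal l * T)"
        unfolding S_def T_def by (intro mult_left_mono superlevel True) simp
      also have "\<dots> = ennreal (p * l powr (p - 1 - 1) * l) * T"
        using True \<open>p > 1\<close> by (subst ennreal_mult) (auto simp: mult.assoc)
      also have "p * l powr (p - 1 - 1) * l = p * l powr (p - 1)"
        using True powr_add[of l "p - 1 - 1" 1] by simp
      finally show ?thesis using True by simp
    qed simp
  qed
  also have "\<dots> = (\<integral>\<^sup>+x. 1 * ennreal_rpow (H x) p \<partial>lborel)"
    using \<open>p > 1\<close> by (intro nn_integral_layer_cake[symmetric]) auto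
  finally show ?thesis by (simp add: H_def)
qed

section \<open>The inequality for norms\<close>

lemma ennreal_rpow_mono:
  assumes "a > 0" "x \<le> y"
  shows "ennreal_rpow x a \<le> ennreal_rpow y a"
proof (cases "y = \<infinity>")
  case False
  with assms(2) have "x \<noteq> \<infinity>" by (auto simp: top_unique)
  with False assms show ?thesis
    by (auto simp: ennreal_rpow_def less_top intro!: ennreal_leI powr_mono2 enn2real_mono)
qed (simp add: ennreal_rpow_def)

lemma ennreal_rpow_mult_ennreal:
  assumes "k \<ge> 0" "x < \<infinity>"
  shows "ennreal_rpow (ennreal k * x) a = ennreal (k powr a) * ennreal_rpow x a"
proof -
  obtain s where "x = ennreal s" "s \<ge> 0" using assms(2) by (cases x) auto
  with assms(1) show ?thesis
    by (simp add: ennreal_rpow_def ennreal_mult[symmetric] powr_mult)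
qed

theorem theorem1p2:
  fixes p :: real and n :: nat and f :: "real \<Rightarrow> real"
  assumes "1 < p"
    and "n \<ge> 1"
    and "in_Lp p f"
  shows "Lp_norm p (hl_max_iter n f)
    \<ge> ennreal ((gamma_seq n * p / (p - 1)) powr (1 / p)) * Lp_norm p (\<lambda>x. ennreal \<bar>f x\<bar>)"
proof -
  define F where "F = (\<lambda>x. ennreal \<bar>f x\<bar>)"
  have "f \<in> borel_measurable lebesgue" and fin: "Lp_norm p F < \<infinity>"
    using \<open>in_Lp p f\<close> by (auto simp: in_Lp_def F_def)
  then have "F \<in> borel_measurable lebesgue"
    unfolding F_def by measurable
  then obtain h where [measurable]: "h \<in> borel_measurable borel" and h: "AE x in lborel. F x = h x"
    using completion_ex_borel_measurable[of F lborel] by auto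
  \<comment> \<open>the first application of the operator erases the difference between \<open>F\<close> and its Borel version \<open>h\<close>\<close>
  obtain k where k: "n = Suc k" using \<open>n \<ge> 1\<close> by (cases n) auto
  have iter: "hl_max_iter n f = (hl_max ^^ n) h"
    unfolding hl_max_iter_def F_def[symmetric] k funpow_Suc_right o_def hl_max_cong_AE[OF h] ..
  define A where "A = (\<integral>\<^sup>+x. ennreal_rpow (h x) p \<partial>lborel)"
  have Lp_F: "Lp_norm p F = ennreal_rpow A (1 / p)"
  proof -
    have "(\<integral>\<^sup>+x. ennreal_rpow (F x) p \<partial>lborel) = A"
      unfolding A_def using h by (intro nn_integral_cong_AE) (auto elim!: eventually_mono)
    then show ?thesis by (simp add: Lp_norm_def nn_integral_completion)
  qed
  have "A < \<infinity>"
    using fin unfolding Lp_F by (cases "A = \<infinity>") (auto simp: ennreal_rpow_def less_top)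
  moreover have "gamma_seq n * p / (p - 1) \<ge> 0"
    using \<open>1 < p\<close> by (simp add: gamma_seq_def g_nonneg)
  ultimately have "ennreal ((gamma_seq n * p / (p - 1)) powr (1 / p)) * Lp_norm p F
      = ennreal_rpow (ennreal (gamma_seq n * p / (p - 1)) * A) (1 / p)"
    unfolding Lp_F by (simp only: ennreal_rpow_mult_ennreal)
  also have "\<dots> \<le> ennreal_rpow (\<integral>\<^sup>+x. ennreal_rpow ((hl_max ^^ n) h x) p \<partial>lborel) (1 / p)"
    unfolding A_def using assms
    by (intro ennreal_rpow_mono nn_integral_powr_funpow_hl_max_ge) auto
  also have "\<dots> = Lp_norm p (hl_max_iter n f)"
    by (simp add: Lp_norm_def nn_integral_completion iter)
  finally show ?thesis by (simp add: F_def)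
qed

end
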